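(* Let $P$ be a finite point set in the plane and $L$ the edge set of a minimum spanning tree of $P$, scaled so that every edge has length at least $1$, and let $g(L)=|\{m:\exists\ell\in L,\ \lceil\lg\ell\rceil=m\}|$. Then $P$ can be strongly connected in $O(g(L))$ slots using uniform power (all links use the same power), or linear power ($P_\ell=\ell^\alpha$); this is achieved on an orientation of the minimum spanning tree.
   Context: A link $(s,r)$ is an ordered pair of points with length $d(s,r)$; $d_{xy}=d(s,r')$ for links $x=(s,r)$, $y=(s',r')$. Constants $\alpha>2$, $\beta\ge1$; noise neglected. A set $S$ of links with given powers is feasible (schedulable in one slot) if $\frac{P_\ell/\ell^\alpha}{\sum_{\ell'\in S\setminus\{\ell\}}P_{\ell'}/d_{\ell'\ell}^\alpha}\ge\beta$ for all $\ell\in S$. Strongly connecting $P$ in $k$ slots means choosing a set of links whose directed graph on $P$ is strongly connected and partitioning it into $k$ feasible sets. Constants in $O(\cdot)$ may depend on $\alpha,\beta$. *)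

theory Defs
  imports "HOL-Analysis.Analysis"
begin

section \<open>Minimum spanning trees of point sets\<close>

text \<open>Undirected edges are two-element sets of points, so the diameter of an edge is the
  distance between its endpoints.\<close>

definition edge_length :: "'a::metric_space set \<Rightarrow> real" where
  "edge_length e = diameter e"

lemma edge_length_pair: "edge_length {u, v} = dist u v"
proof -
  have "dist u v \<le> diameter {u, v}"
    by (intro diameter_bounded_bound) auto
  moreover have "diameter {u, v} \<le> dist u v"
    unfolding diameter_def by (auto intro!: cSup_least simp: dist_commute)
  ultimately show ?thesis by (simp add: edge_length_def)
qed

definition edges_on :: "'a set \<Rightarrow> 'a set set" where
  "edges_on V = {{u, v} | u v. u \<in> V \<and> v \<in> V \<and> u \<noteq> v}"

definition is_cycle :: "'a set set \<Rightarrow> 'a list \<Rightarrow> bool" where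
  "is_cycle E vs \<longleftrightarrow> length vs \<ge> 3 \<and> distinct vs \<and>
     (\<forall>i < length vs. {vs ! i, vs ! (Suc i mod length vs)} \<in> E)"

definition spanning_tree :: "'a set \<Rightarrow> 'a set set \<Rightarrow> bool" where
  "spanning_tree V E \<longleftrightarrow> E \<subseteq> edges_on V \<and>
     (\<forall>u\<in>V. \<forall>v\<in>V. (u, v) \<in> {(x, y). {x, y} \<in> E}\<^sup>*) \<and>
     (\<nexists>vs. is_cycle E vs)"

definition minimum_spanning_tree :: "'a::metric_space set \<Rightarrow> 'a set set \<Rightarrow> bool" where
  "minimum_spanning_tree V E \<longleftrightarrow> spanning_tree V E \<and>
     (\<forall>E'. spanning_tree V E' \<longrightarrow> (\<Sum>e\<in>E. edge_length e) \<le> (\<Sum>e\<in>E'. edge_length e))"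

definition length_diversity :: "'a::metric_space set set \<Rightarrow> nat" where
  "length_diversity L = card {m. \<exists>e\<in>L. \<lceil>log 2 (edge_length e)\<rceil> = m}"


section \<open>Links and feasibility\<close>

type_synonym point = "real^2"
type_synonym link = "point \<times> point"  \<comment> \<open>(sender, receiver)\<close>

definition link_length :: "link \<Rightarrow> real" where
  "link_length l = dist (fst l) (snd l)"

definition link_dist :: "link \<Rightarrow> link \<Rightarrow> real" where
  "link_dist x y = dist (fst x) (snd y)"

text \<open>The ratio is taken in the extended nonnegative reals. There, an interferer located at the
  receiver of a link (distance 0) contributes infinite interference and makes the ratio 0, while
  a link that is alone in its slot (interference 0) has ratio infinity. In the reals, division
  by zero would yield 0 in both cases.\<close>

definition sir :: "real \<Rightarrow> (link \<Rightarrow> real) \<Rightarrow> link set \<Rightarrow> link \<Rightarrow> ennreal" where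
  "sir \<alpha> pw S l =
     (ennreal (pw l) / ennreal (link_length l powr \<alpha>)) /
     (\<Sum>l'\<in>S - {l}. ennreal (pw l') / ennreal (link_dist l' l powr \<alpha>))"

definition feasible :: "real \<Rightarrow> real \<Rightarrow> (link \<Rightarrow> real) \<Rightarrow> link set \<Rightarrow> bool" where
  "feasible \<alpha> \<beta> pw S \<longleftrightarrow> (\<forall>l\<in>S. sir \<alpha> pw S l \<ge> ennreal \<beta>)"

text \<open>The power assignment is one function for all slots.\<close>

definition uniform_power :: "real \<Rightarrow> link \<Rightarrow> real" where
  "uniform_power p = (\<lambda>l. p)"

definition linear_power :: "real \<Rightarrow> link \<Rightarrow> real" where
  "linear_power \<alpha> = (\<lambda>l. link_length l powr \<alpha>)"

definition strongly_connects :: "link set \<Rightarrow> point set \<Rightarrow> bool" where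
  "strongly_connects S P \<longleftrightarrow> S \<subseteq> P \<times> P \<and> (\<forall>l\<in>S. fst l \<noteq> snd l) \<and>
     (\<forall>u\<in>P. \<forall>v\<in>P. (u, v) \<in> S\<^sup>*)"

definition schedulable :: "real \<Rightarrow> real \<Rightarrow> (link \<Rightarrow> real) \<Rightarrow> link set \<Rightarrow> nat \<Rightarrow> bool" where
  "schedulable \<alpha> \<beta> pw S k \<longleftrightarrow>
     (\<exists>Q. partition_on S Q \<and> finite Q \<and> card Q = k \<and> (\<forall>A\<in>Q. feasible \<alpha> \<beta> pw A))"

text \<open>Every link is a directed copy of an edge, and every edge carries at least one link.
  Both directions of an edge are allowed: a tree with at least two vertices needs both
  directions of each of its edges in order to be strongly connected.\<close>

definition orientation_of :: "point set set \<Rightarrow> link set \<Rightarrow> bool" where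
  "orientation_of L S \<longleftrightarrow> (\<lambda>(s, r). {s, r}) ` S = L"

end

theory Submission
  imports Defs
begin

text \<open>Take both directions of every tree edge. Within the class of links of length in (2h, 4h],
  place a grid of cells of side h. By the bottleneck property, points at distance at most 2h are
  joined by tree edges of length at most 2h, so two tree edges of the class running between the
  same pair of cells would close a cycle. Hence, colouring a link by its class and by the cells of
  its endpoints modulo a constant K, the senders of one colour occupy distinct cells of a
  sublattice of index K in each coordinate. A sender displaced by (a, b) sublattice steps
  contributes at most a constant times K to the power -\<alpha> times
  ((1 + |a|) (1 + |b|)) to the power -\<alpha>/2, relative to the signal. This is summable since
  \<alpha> > 2, so a large K makes every colour class feasible. Lengths within a class differ by at most a
  factor 2, so uniform and linear power obey the same bound.\<close>

section \<open>Connectivity by undirected edges\<close>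

text \<open>The relation that \<open>spanning_tree\<close> writes inline. Applied to the tree it is
  also the link set of the final theorem, since it contains both directions of every edge.\<close>

definition adj :: "'a set set \<Rightarrow> ('a \<times> 'a) set" where
  "adj E = {(x, y). {x, y} \<in> E}"

lemma sym_adj: "sym (adj E)"
  by (auto simp: adj_def sym_def insert_commute)

lemma adj_rtrancl_sym: "(x, y) \<in> (adj E)\<^sup>* \<Longrightarrow> (y, x) \<in> (adj E)\<^sup>*"
  using sym_rtrancl[OF sym_adj] by (rule symD)

lemma adj_rtrancl_mono: "E \<subseteq> F \<Longrightarrow> (x, y) \<in> (adj E)\<^sup>* \<Longrightarrow> (x, y) \<in> (adj F)\<^sup>*"
  by (rule subsetD[OF rtrancl_mono]) (auto simp: adj_def)

text \<open>A walk that cannot avoid \<open>e\<close> is cut at \<open>e\<close>: one end of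
  \<open>e\<close> is reached from the start without \<open>e\<close>, and the other end leads on to
  the target without \<open>e\<close>. Several crossings collapse into one.\<close>

lemma adj_rtrancl_remove:
  assumes "(u, v) \<in> (adj F)\<^sup>*"
  shows "(u, v) \<in> (adj (F - {e}))\<^sup>* \<or>
    (\<exists>x y. e = {x, y} \<and> (u, x) \<in> (adj (F - {e}))\<^sup>* \<and> (y, v) \<in> (adj (F - {e}))\<^sup>*)"
  using assms
proof (induction rule: rtrancl_induct)
  case (step y z)
  show ?case
  proof (cases "{y, z} = e")
    case True
    from step.IH show ?thesis
    proof (elim disjE exE conjE)
      assume "(u, y) \<in> (adj (F - {e}))\<^sup>*"
      then show ?thesis using True by blast
    next
      fix a b
      assume ab: "e = {a, b}" "(u, a) \<in> (adj (F - {e}))\<^sup>*" "(b, y) \<in> (adj (F - {e}))\<^sup>*"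
      \<comment> \<open>A further crossing ends either at \<open>a\<close>, already reached from
        \<open>u\<close> without \<open>e\<close>, or at \<open>b\<close>, where an empty tail
        remains.\<close>
      with True have "z = a \<or> z = b" by blast
      with ab show ?thesis by blast
    qed
  next
    case False
    with step.hyps have "(y, z) \<in> adj (F - {e})" by (auto simp: adj_def)
    with step.IH show ?thesis by (blast intro: rtrancl.rtrancl_into_rtrancl)
  qed
qed simp

text \<open>The one remaining crossing of the edge is replaced by the detour in \<open>E\<close>. As
  the edge may be crossed in either direction, the detour is needed in both, which symmetry
  supplies.\<close>

lemma adj_rtrancl_bypass:
  assumes "(u, v) \<in> (adj F)\<^sup>*" "F - {{x, y}} \<subseteq> E" "(x, y) \<in> (adj E)\<^sup>*"
  shows "(u, v) \<in> (adj E)\<^sup>*"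
proof -
  have xy: "(a, b) \<in> (adj E)\<^sup>*" if "{x, y} = {a, b}" for a b
    using that assms(3) adj_rtrancl_sym[OF assms(3)] by (auto simp: doubleton_eq_iff)
  from adj_rtrancl_remove[OF assms(1), of "{x, y}"] show ?thesis
  proof (elim disjE exE conjE)
    fix a b
    assume "{x, y} = {a, b}" "(u, a) \<in> (adj (F - {{x, y}}))\<^sup>*" "(b, v) \<in> (adj (F - {{x, y}}))\<^sup>*"
    then show ?thesis
      using adj_rtrancl_mono[OF assms(2)] xy by (meson rtrancl_trans)
  qed (rule adj_rtrancl_mono[OF assms(2)])
qed

text \<open>A shortest walk from \<open>u\<close> to \<open>v\<close> avoiding the edge has no
  repeated vertex, and the edge closes it to a cycle.\<close>

lemma cycle_if_bypass:
  assumes "{u, v} \<in> E" "u \<noteq> v" "(u, v) \<in> (adj (E - {{u, v}}))\<^sup>*"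
  shows "\<exists>vs. is_cycle E vs"
proof -
  let ?r = "adj (E - {{u, v}})"
  define n where "n = (LEAST n. (u, v) \<in> ?r ^^ n)"
  have "\<exists>n. (u, v) \<in> ?r ^^ n" using assms(3) by (simp add: rtrancl_power)
  then have n: "(u, v) \<in> ?r ^^ n" unfolding n_def by (rule LeastI_ex)
  have min: "n \<le> m" if "(u, v) \<in> ?r ^^ m" for m
    unfolding n_def using that by (rule Least_le)
  from n obtain f where f: "f 0 = u" "f n = v" "\<And>i. i < n \<Longrightarrow> (f i, f (Suc i)) \<in> ?r"
    by (auto simp: relpow_fun_conv)
  \<comment> \<open>Cutting out the stretch between two visits of the same vertex would leave a
    shorter walk.\<close>
  have no_repeat: "f i \<noteq> f j" if "i < j" "j \<le> n" for i j
  proof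
    assume eq: "f i = f j"
    have "(u, f i) \<in> ?r ^^ i"
      unfolding relpow_fun_conv using f that by (intro exI[of _ f]) auto
    moreover have "(f j, v) \<in> ?r ^^ (n - j)"
      unfolding relpow_fun_conv using f that by (intro exI[of _ "\<lambda>k. f (j + k)"]) auto
    ultimately have "(u, v) \<in> ?r ^^ (i + (n - j))"
      using eq by (auto simp: relpow_add)
    from min[OF this] that show False by simp
  qed
  have "n \<noteq> 0" using f(1,2) assms(2) by metis
  \<comment> \<open>A walk of one step would be the removed edge itself. Hence the walk has at least
    three vertices, as \<open>is_cycle\<close> demands.\<close>
  moreover have "n \<noteq> 1" using f(3)[of 0] f(1,2) by (auto simp: adj_def)
  ultimately have "n \<ge> 2" by simp
  have "inj_on f {..<Suc n}"
    using no_repeat unfolding inj_on_def by (metis lessThan_iff less_Suc_eq_le linorder_neqE_nat)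
  then have "distinct (map f [0..<Suc n])"
    by (simp add: distinct_map atLeast0LessThan del: upt_Suc)
  moreover have "{f i, f (Suc i mod Suc n)} \<in> E" if "i < Suc n" for i
  proof (cases "i = n")
    case True
    then show ?thesis using f assms(1) by (simp add: insert_commute)
  next
    case False
    with that show ?thesis using f(3)[of i] by (auto simp: adj_def)
  qed
  ultimately have "is_cycle E (map f [0..<Suc n])"
    using \<open>n \<ge> 2\<close> by (auto simp: is_cycle_def simp del: upt_Suc)
  then show ?thesis by blast
qed

text \<open>The edge from the last vertex back to the first is bypassed by the rest of the
  cycle.\<close>

lemma cycle_bypass:
  assumes "is_cycle E vs"
  shows "\<exists>x y. {x, y} \<in> E \<and> (x, y) \<in> (adj (E - {{x, y}}))\<^sup>*"
proof -
  let ?n = "length vs"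
  let ?x = "vs ! 0" and ?y = "vs ! (?n - 1)"
  let ?r = "adj (E - {{?x, ?y}})"
  have n: "?n \<ge> 3" and dist: "distinct vs"
    and edge: "\<And>i. i < ?n \<Longrightarrow> {vs ! i, vs ! (Suc i mod ?n)} \<in> E"
    using assms by (auto simp: is_cycle_def)
  have "vs \<noteq> []" using n by auto
  have "(?x, vs ! i) \<in> ?r\<^sup>*" if "i < ?n" for i
    using that
  proof (induction i)
    case (Suc i)
    have "{vs ! i, vs ! Suc i} \<in> E" using edge[of i] Suc.prems by simp
    \<comment> \<open>By distinctness, a consecutive pair equal to the closing pair would mean a
      cycle with only two vertices.\<close>
    moreover have "{vs ! i, vs ! Suc i} \<noteq> {?x, ?y}"
    proof
      assume "{vs ! i, vs ! Suc i} = {?x, ?y}"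
      moreover have "vs ! Suc i \<noteq> ?x"
        using dist n Suc.prems by (subst nth_eq_iff_index_eq) auto
      ultimately have "vs ! i = ?x" "vs ! Suc i = ?y" by (auto simp: doubleton_eq_iff)
      then have "i = 0" "Suc i = ?n - 1"
        using n Suc.prems \<open>vs \<noteq> []\<close> nth_eq_iff_index_eq[OF dist, of i 0]
          nth_eq_iff_index_eq[OF dist, of "Suc i" "?n - 1"] by auto
      with n show False by simp
    qed
    ultimately have "(vs ! i, vs ! Suc i) \<in> ?r" by (auto simp: adj_def)
    with Suc show ?case by (meson Suc_lessD rtrancl.rtrancl_into_rtrancl)
  qed simp
  then have "(?x, ?y) \<in> ?r\<^sup>*" using n by simp
  moreover have "Suc (?n - 1) mod ?n = 0" using n by (cases vs) auto
  then have "{?x, ?y} \<in> E" using edge[of "?n - 1"] n by (simp add: insert_commute)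
  ultimately show ?thesis by blast
qed

section \<open>Bottleneck property of minimum spanning trees\<close>

definition connects :: "'a set set \<Rightarrow> 'a set \<Rightarrow> bool" where
  "connects E V \<longleftrightarrow> (\<forall>u\<in>V. \<forall>v\<in>V. (u, v) \<in> (adj E)\<^sup>*)"

lemma spanning_tree_iff:
  "spanning_tree V E \<longleftrightarrow> E \<subseteq> edges_on V \<and> connects E V \<and> (\<nexists>vs. is_cycle E vs)"
  by (simp add: spanning_tree_def connects_def adj_def)

lemma finite_edges_on: "finite V \<Longrightarrow> finite (edges_on V)"
  by (rule finite_subset[of _ "Pow V"]) (auto simp: edges_on_def)

lemma connects_contains_spanning_tree:
  assumes "finite V" "E \<subseteq> edges_on V" "connects E V"
  shows "\<exists>T\<subseteq>E. spanning_tree V T"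
proof -
  have "finite E" using assms finite_edges_on finite_subset by blast
  then have "finite {F. F \<subseteq> E \<and> connects F V}" by simp
  moreover have "E \<in> {F. F \<subseteq> E \<and> connects F V}" using assms by simp
  ultimately obtain T where T: "T \<subseteq> E" "connects T V"
    and min: "\<And>F. F \<subseteq> E \<Longrightarrow> connects F V \<Longrightarrow> F \<subseteq> T \<Longrightarrow> F = T"
    using finite_has_minimal2[of "{F. F \<subseteq> E \<and> connects F V}" E]
    by (metis (mono_tags, lifting) mem_Collect_eq)
  have "\<nexists>vs. is_cycle T vs"
  proof
    assume "\<exists>vs. is_cycle T vs"
    then obtain x y where xy: "{x, y} \<in> T" "(x, y) \<in> (adj (T - {{x, y}}))\<^sup>*"
      using cycle_bypass by blast
    have "connects (T - {{x, y}}) V"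
      using T(2) adj_rtrancl_bypass[OF _ order_refl xy(2)] by (auto simp: connects_def)
    with min[of "T - {{x, y}}"] T xy(1) show False by blast
  qed
  with T assms(2) have "spanning_tree V T" unfolding spanning_tree_iff by blast
  with T show ?thesis by blast
qed

lemma edge_length_nonneg: "e \<in> edges_on V \<Longrightarrow> edge_length e \<ge> 0"
  by (auto simp: edges_on_def edge_length_pair)

text \<open>Minimality carries over from trees to all connecting edge sets, so the exchange argument
  below need not show that the exchanged set is acyclic.\<close>

lemma mst_le_connects:
  assumes "finite V" "minimum_spanning_tree V L" "E \<subseteq> edges_on V" "connects E V"
  shows "(\<Sum>e\<in>L. edge_length e) \<le> (\<Sum>e\<in>E. edge_length e)"
proof -
  obtain T where T: "T \<subseteq> E" "spanning_tree V T"
    using connects_contains_spanning_tree[OF assms(1,3,4)] by blast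
  have "(\<Sum>e\<in>L. edge_length e) \<le> (\<Sum>e\<in>T. edge_length e)"
    using T(2) assms(2) by (simp add: minimum_spanning_tree_def)
  also have "\<dots> \<le> (\<Sum>e\<in>E. edge_length e)"
    using assms finite_subset[OF assms(3) finite_edges_on] T edge_length_nonneg
    by (intro sum_mono2) auto
  finally show ?thesis .
qed

text \<open>In an inclusion-minimal \<open>F\<close> joining \<open>u\<close> and \<open>v\<close>
  inside the tree, every edge separates \<open>u\<close> from \<open>v\<close>. If one were longer
  than \<open>h\<close>, exchanging it for \<open>{u, v}\<close> would keep the tree connected and
  make it lighter.\<close>

lemma mst_bottleneck:
  assumes V: "finite V" and L: "minimum_spanning_tree V L"
    and uv: "u \<in> V" "v \<in> V" "dist u v \<le> h"
  shows "(u, v) \<in> (adj {e\<in>L. edge_length e \<le> h})\<^sup>*"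
proof (cases "u = v")
  case False
  have sub: "L \<subseteq> edges_on V" and con: "connects L V"
    using L by (auto simp: minimum_spanning_tree_def spanning_tree_iff)
  have fin: "finite L" using sub V finite_edges_on finite_subset by blast
  then have "finite {F. F \<subseteq> L \<and> (u, v) \<in> (adj F)\<^sup>*}" by simp
  moreover have "L \<in> {F. F \<subseteq> L \<and> (u, v) \<in> (adj F)\<^sup>*}"
    using con uv by (auto simp: connects_def)
  ultimately obtain F where F: "F \<subseteq> L" "(u, v) \<in> (adj F)\<^sup>*"
    and min: "\<And>G. G \<subseteq> L \<Longrightarrow> (u, v) \<in> (adj G)\<^sup>* \<Longrightarrow> G \<subseteq> F \<Longrightarrow> G = F"
    using finite_has_minimal2[of "{F. F \<subseteq> L \<and> (u, v) \<in> (adj F)\<^sup>*}" L]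
    by (metis (mono_tags, lifting) mem_Collect_eq)
  have "edge_length e \<le> h" if e: "e \<in> F" for e
  proof (rule ccontr)
    assume long: "\<not> edge_length e \<le> h"
    let ?E = "insert {u, v} (L - {e})"
    have "(u, v) \<notin> (adj (F - {e}))\<^sup>*" using min[of "F - {e}"] F e by blast
    then obtain x y where xy: "e = {x, y}" "(u, x) \<in> (adj (F - {e}))\<^sup>*" "(y, v) \<in> (adj (F - {e}))\<^sup>*"
      using adj_rtrancl_remove[OF F(2)] by blast
    have FE: "F - {e} \<subseteq> ?E" using F(1) by blast
    have "(u, v) \<in> adj ?E" by (simp add: adj_def)
    moreover have "(x, u) \<in> (adj ?E)\<^sup>*" "(v, y) \<in> (adj ?E)\<^sup>*"
      using xy(2,3) by (simp_all only: adj_rtrancl_mono[OF FE] adj_rtrancl_sym)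
    ultimately have "(x, y) \<in> (adj ?E)\<^sup>*" by (meson r_into_rtrancl rtrancl_trans)
    moreover have "L - {{x, y}} \<subseteq> ?E" using xy(1) by blast
    ultimately have "connects ?E V"
      using con unfolding connects_def by (blast intro: adj_rtrancl_bypass)
    moreover have "?E \<subseteq> edges_on V" using sub uv False by (auto simp: edges_on_def)
    ultimately have "(\<Sum>e\<in>L. edge_length e) \<le> (\<Sum>e\<in>?E. edge_length e)"
      using mst_le_connects[OF V L] by blast
    \<comment> \<open>Only an inequality, as \<open>{u, v}\<close> may already belong to
      \<open>L - {e}\<close>.\<close>
    also have "\<dots> \<le> dist u v + (\<Sum>e\<in>L - {e}. edge_length e)"
      using fin by (simp add: sum.insert_if edge_length_pair)
    also have "\<dots> < edge_length e + (\<Sum>e\<in>L - {e}. edge_length e)"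
      using long uv(3) by simp
    also have "\<dots> = (\<Sum>e\<in>L. edge_length e)"
      using fin e F(1) by (subst sum.remove[of L e]) auto
    finally show False by simp
  qed
  then have "F \<subseteq> {e\<in>L. edge_length e \<le> h}" using F(1) by blast
  then show ?thesis using F(2) by (rule adj_rtrancl_mono)
qed simp

text \<open>Otherwise short edges from \<open>u\<close> to \<open>u'\<close>, the edge to
  \<open>v'\<close>, and short edges on to \<open>v\<close> would bypass \<open>{u, v}\<close> and
  yield a cycle in the tree.\<close>

lemma mst_long_edge_unique:
  assumes V: "finite V" and L: "minimum_spanning_tree V L"
    and e: "{u, v} \<in> L" "{u', v'} \<in> L" "dist u v > h" "dist u' v' > h"
    and near: "dist u u' \<le> h" "dist v v' \<le> h"
  shows "{u, v} = {u', v'}"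
proof (rule ccontr)
  assume neq: "{u, v} \<noteq> {u', v'}"
  let ?E = "L - {{u, v}}"
  have sub: "L \<subseteq> edges_on V" and acyclic: "\<nexists>vs. is_cycle L vs"
    using L by (auto simp: minimum_spanning_tree_def spanning_tree_iff)
  have in_V: "a \<in> V" "b \<in> V" "a \<noteq> b" if "{a, b} \<in> L" for a b
    using subsetD[OF sub that] by (auto simp: edges_on_def doubleton_eq_iff)
  \<comment> \<open>The removed edge is longer than \<open>h\<close>, so every path supplied by the
    bottleneck property survives its removal.\<close>
  have short: "{e\<in>L. edge_length e \<le> h} \<subseteq> ?E"
    using e(3) by (auto simp: edge_length_pair)
  have "(u, u') \<in> (adj ?E)\<^sup>*" "(v', v) \<in> (adj ?E)\<^sup>*"
    using in_V[OF e(1)] in_V[OF e(2)] near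
    by (auto intro!: adj_rtrancl_mono[OF short] mst_bottleneck[OF V L] simp: dist_commute)
  moreover have "(u', v') \<in> adj ?E" using neq e(2) by (auto simp: adj_def)
  ultimately have "(u, v) \<in> (adj ?E)\<^sup>*" by (meson r_into_rtrancl rtrancl_trans)
  then show False
    using cycle_if_bypass[OF e(1)] in_V(3)[OF e(1)] acyclic by blast
qed

section \<open>Interference of senders spread over a grid\<close>

definition cell :: "real \<Rightarrow> point \<Rightarrow> int \<times> int" where
  "cell w z = (\<lfloor>z $ 1 / w\<rfloor>, \<lfloor>z $ 2 / w\<rfloor>)"

text \<open>The l1 norm gives the factor 2 instead of the square root of 2. This is good enough
  because links of a class are longer than twice the cell width.\<close>

lemma dist_same_cell:
  assumes "w > 0" "cell w x = cell w y"
  shows "dist x y \<le> 2 * w"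
proof -
  have *: "\<bar>a - b\<bar> \<le> w" if "\<lfloor>a / w\<rfloor> = \<lfloor>b / w\<rfloor>" for a b
  proof -
    have "\<bar>a / w - b / w\<bar> \<le> 1" using that by linarith
    then show ?thesis using assms(1) by (simp add: diff_divide_distrib[symmetric] abs_divide)
  qed
  have "dist x y \<le> (\<Sum>i\<in>UNIV. \<bar>(x - y) $ i\<bar>)"
    unfolding dist_norm by (rule norm_le_l1_cart)
  also have "\<dots> \<le> 2 * w"
    using assms *[of "x $ 1" "y $ 1"] *[of "x $ 2" "y $ 2"] by (simp add: UNIV_2 cell_def)
  finally show ?thesis .
qed

text \<open>One cell width is lost to the positions of the two points within their cells.\<close>

lemma dist_ge_floor_diff:
  fixes x y :: "real^'n"
  assumes "w > 0"
  shows "(real_of_int \<bar>\<lfloor>x $ i / w\<rfloor> - \<lfloor>y $ i / w\<rfloor>\<bar> - 1) * w \<le> dist x y"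
proof -
  have "real_of_int \<bar>\<lfloor>x $ i / w\<rfloor> - \<lfloor>y $ i / w\<rfloor>\<bar> - 1 \<le> \<bar>x $ i / w - y $ i / w\<bar>"
    by linarith
  then have "(real_of_int \<bar>\<lfloor>x $ i / w\<rfloor> - \<lfloor>y $ i / w\<rfloor>\<bar> - 1) * w \<le> \<bar>x $ i - y $ i\<bar>"
    using assms by (simp add: diff_divide_distrib[symmetric] abs_divide pos_le_divide_eq)
  also have "\<dots> \<le> dist x y"
    using component_le_norm_cart[of "x - y" i] by (simp add: dist_norm)
  finally show ?thesis .
qed

lemma floor_diff_le_of_dist:
  fixes x y :: "real^'n"
  assumes "w > 0" "dist x y \<le> real c * w"
  shows "\<bar>\<lfloor>x $ i / w\<rfloor> - \<lfloor>y $ i / w\<rfloor>\<bar> \<le> int c + 1"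
proof -
  have "(real_of_int \<bar>\<lfloor>x $ i / w\<rfloor> - \<lfloor>y $ i / w\<rfloor>\<bar> - 1) * w \<le> real c * w"
    using dist_ge_floor_diff[OF assms(1)] assms(2) by (rule order_trans)
  then show ?thesis using assms(1) by simp
qed

text \<open>Each of the two coordinates receives half of the exponent, so that sums over
  displacements factor; \<alpha> > 2 makes each factor summable. The added 1 covers displacement
  0.\<close>

definition decay :: "real \<Rightarrow> int \<Rightarrow> real" where
  "decay \<alpha> a = (1 + \<bar>real_of_int a\<bar>) powr (- (\<alpha> / 2))"

text \<open>An upper bound for the sum over all integers: the series over the naturals is taken once
  for each sign, so 0 counts twice.\<close>

definition decay_total :: "real \<Rightarrow> real" where
  "decay_total \<alpha> = 2 * (\<Sum>n. decay \<alpha> (int n))"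

lemma summable_decay:
  assumes "\<alpha> > 2"
  shows "summable (\<lambda>n. decay \<alpha> (int n))"
proof -
  have "summable (\<lambda>n. real n powr (- (\<alpha> / 2)))"
    using assms by (simp add: summable_real_powr_iff)
  then have "summable (\<lambda>n. real (Suc n) powr (- (\<alpha> / 2)))"
    by (subst summable_Suc_iff)
  then show ?thesis by (simp add: decay_def add.commute)
qed

lemma sum_decay_le:
  assumes "\<alpha> > 2" "finite A"
  shows "(\<Sum>a\<in>A. decay \<alpha> a) \<le> decay_total \<alpha>"
proof -
  have half: "(\<Sum>a\<in>B. decay \<alpha> a) \<le> (\<Sum>n. decay \<alpha> (int n))"
    if "finite B" "inj_on (\<lambda>a. nat \<bar>a\<bar>) B" for B
  proof -
    have "(\<Sum>a\<in>B. decay \<alpha> a) = (\<Sum>n\<in>(\<lambda>a. nat \<bar>a\<bar>) ` B. decay \<alpha> (int n))"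
      by (subst sum.reindex[OF that(2)]) (simp add: decay_def)
    also have "\<dots> \<le> (\<Sum>n. decay \<alpha> (int n))"
      using that by (intro sum_le_suminf summable_decay[OF assms(1)]) (auto simp: decay_def)
    finally show ?thesis .
  qed
  have "A = {a\<in>A. a \<ge> 0} \<union> {a\<in>A. a < 0}" by auto
  then have "(\<Sum>a\<in>A. decay \<alpha> a) = (\<Sum>a\<in>{a\<in>A. a \<ge> 0} \<union> {a\<in>A. a < 0}. decay \<alpha> a)" by simp
  also have "\<dots> = (\<Sum>a\<in>{a\<in>A. a \<ge> 0}. decay \<alpha> a) + (\<Sum>a\<in>{a\<in>A. a < 0}. decay \<alpha> a)"
    using assms(2) by (intro sum.union_disjoint) auto
  also have "\<dots> \<le> decay_total \<alpha>"
    unfolding decay_total_def mult_2 using assms(2)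
    by (intro add_mono half) (auto simp: inj_on_def)
  finally show ?thesis .
qed

text \<open>With M the larger absolute value, M \<ge> 1 bounds both 1 + |a| and 1 + |b| by 2 M. The
  negative exponent reverses the resulting bound on the product.\<close>

lemma powr_max_le_decay:
  fixes a b :: int
  assumes "\<alpha> > 0" "(a, b) \<noteq> (0, 0)"
  shows "(2 * real_of_int (max \<bar>a\<bar> \<bar>b\<bar>)) powr - \<alpha> \<le> decay \<alpha> a * decay \<alpha> b"
proof -
  let ?M = "real_of_int (max \<bar>a\<bar> \<bar>b\<bar>)"
  have "max \<bar>a\<bar> \<bar>b\<bar> \<ge> 1" using assms(2) by (auto simp: max_def)
  then have M: "?M \<ge> 1" by linarith
  have "(1 + \<bar>real_of_int a\<bar>) * (1 + \<bar>real_of_int b\<bar>) \<le> (2 * ?M) * (2 * ?M)"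
    using M by (intro mult_mono) auto
  then have "((2 * ?M) * (2 * ?M)) powr (- (\<alpha> / 2)) \<le>
      ((1 + \<bar>real_of_int a\<bar>) * (1 + \<bar>real_of_int b\<bar>)) powr (- (\<alpha> / 2))"
    using assms(1) by (intro powr_mono2') (auto intro: mult_pos_pos)
  also have "\<dots> = decay \<alpha> a * decay \<alpha> b"
    by (simp add: decay_def powr_mult)
  finally show ?thesis
    using M by (subst (asm) powr_mult) (auto simp: powr_add[symmetric])
qed

text \<open>The sender of \<open>x\<close> lies \<open>K\<close> times (\<open>p x\<close>,
  \<open>q x\<close>) cells away from that of \<open>l\<close>, and these displacements are
  distinct. Since 4 \<open>w\<close> bounds the length of \<open>l\<close>, the sum dominates the
  interference relative to the signal.\<close>

lemma grid_interference:
  fixes A :: "link set" and K :: nat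
  assumes \<alpha>: "\<alpha> > 2" and w: "w > 0" and K: "K \<ge> 10" and A: "finite A" "l \<in> A"
    and len: "link_length l \<le> 4 * w"
    and inj: "inj_on (\<lambda>x. cell w (fst x)) A"
    and cong: "\<And>x. x \<in> A \<Longrightarrow> int K dvd fst (cell w (fst x)) - fst (cell w (fst l))"
      "\<And>x. x \<in> A \<Longrightarrow> int K dvd snd (cell w (fst x)) - snd (cell w (fst l))"
  shows "\<And>x. x \<in> A - {l} \<Longrightarrow> link_dist x l > 0"
    and "(\<Sum>x\<in>A - {l}. (4 * w / link_dist x l) powr \<alpha>) \<le> (16 / K) powr \<alpha> * (decay_total \<alpha>)\<^sup>2"
proof -
  define p where "p x = (fst (cell w (fst x)) - fst (cell w (fst l))) div int K" for x :: link
  define q where "q x = (snd (cell w (fst x)) - snd (cell w (fst l))) div int K" for x :: link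
  have p: "fst (cell w (fst x)) - fst (cell w (fst l)) = int K * p x" if "x \<in> A" for x
    using cong(1)[OF that] by (simp add: p_def)
  have q: "snd (cell w (fst x)) - snd (cell w (fst l)) = int K * q x" if "x \<in> A" for x
    using cong(2)[OF that] by (simp add: q_def)
  have inj_pq: "inj_on (\<lambda>x. (p x, q x)) A"
  proof (rule inj_onI)
    fix x y assume xy: "x \<in> A" "y \<in> A" "(p x, q x) = (p y, q y)"
    then have "cell w (fst x) = cell w (fst y)"
      using p[of x] p[of y] q[of x] q[of y] by (simp add: prod_eq_iff)
    then show "x = y" using inj xy by (auto dest: inj_onD)
  qed
  have nz: "(p x, q x) \<noteq> (0, 0)" if "x \<in> A - {l}" for x
    using inj_onD[OF inj_pq, of x l] that A(2) by (auto simp: p_def q_def)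
  have far: "link_dist x l \<ge> (K / 2) * real_of_int (max \<bar>p x\<bar> \<bar>q x\<bar>) * w"
    and M1: "max \<bar>p x\<bar> \<bar>q x\<bar> \<ge> 1" if x: "x \<in> A - {l}" for x
  proof -
    let ?M = "real_of_int (max \<bar>p x\<bar> \<bar>q x\<bar>)"
    show M1: "max \<bar>p x\<bar> \<bar>q x\<bar> \<ge> 1" using nz[OF x] by (auto simp: max_def)
    have "(K * real_of_int \<bar>p x\<bar> - 1) * w \<le> dist (fst x) (fst l)"
      using dist_ge_floor_diff[OF w, of "fst x" 1 "fst l"] p[of x] x
      by (simp add: cell_def abs_mult del: of_int_diff)
    moreover have "(K * real_of_int \<bar>q x\<bar> - 1) * w \<le> dist (fst x) (fst l)"
      using dist_ge_floor_diff[OF w, of "fst x" 2 "fst l"] q[of x] x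
      by (simp add: cell_def abs_mult del: of_int_diff)
    ultimately have 1: "(K * ?M - 1) * w \<le> dist (fst x) (fst l)"
      by (auto simp: max_def)
    have 2: "dist (fst x) (fst l) \<le> link_dist x l + link_length l"
      using dist_triangle[of "fst x" "fst l" "snd l"]
      by (simp add: link_dist_def link_length_def dist_commute)
    \<comment> \<open>The distance loses one cell width to rounding and up to four to the length of
      \<open>l\<close>. From \<open>K\<close> times \<open>?M\<close> at least 10, these five are at
      most half of the separation.\<close>
    have "real K * ?M \<ge> 10 * 1" using K M1 by (intro mult_mono) auto
    then have "(K / 2) * ?M * w \<le> (K * ?M - 5) * w"
      using w by (intro mult_right_mono) auto
    with 1 2 len show "link_dist x l \<ge> (K / 2) * ?M * w" by (simp add: algebra_simps)
  qed
  show pos: "link_dist x l > 0" if "x \<in> A - {l}" for x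
  proof -
    have "0 < (K / 2) * real_of_int (max \<bar>p x\<bar> \<bar>q x\<bar>) * w"
      using M1[OF that] K w by (intro mult_pos_pos) linarith+
    with far[OF that] show ?thesis by linarith
  qed
  have inv: "inverse y powr \<alpha> = y powr - \<alpha>" if "y > 0" for y :: real
    using that by (simp add: powr_minus inverse_powr)
  have term_le: "(4 * w / link_dist x l) powr \<alpha> \<le> (16 / K) powr \<alpha> * (decay \<alpha> (p x) * decay \<alpha> (q x))"
    if x: "x \<in> A - {l}" for x
  proof -
    let ?M = "real_of_int (max \<bar>p x\<bar> \<bar>q x\<bar>)"
    have M: "?M \<ge> 1" using M1[OF x] by linarith
    have "0 < (K / 2) * ?M * w" using M K w by (intro mult_pos_pos) linarith+
    then have "4 * w / link_dist x l \<le> 4 * w / ((K / 2) * ?M * w)"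
      using far[OF x] pos[OF x] w by (intro divide_left_mono) auto
    also have "\<dots> = (16 / K) * inverse (2 * ?M)"
      using w K M by (simp add: field_simps)
    finally have "(4 * w / link_dist x l) powr \<alpha> \<le> ((16 / K) * inverse (2 * ?M)) powr \<alpha>"
      using \<alpha> w pos[OF x] by (intro powr_mono2) auto
    also have "\<dots> = (16 / K) powr \<alpha> * (2 * ?M) powr - \<alpha>"
      by (subst powr_mult, subst inv) (use M in auto)
    also have "\<dots> \<le> (16 / K) powr \<alpha> * (decay \<alpha> (p x) * decay \<alpha> (q x))"
      using powr_max_le_decay[OF _ nz[OF x]] \<alpha> by (intro mult_left_mono) auto
    finally show ?thesis .
  qed
  have "(\<Sum>x\<in>A - {l}. decay \<alpha> (p x) * decay \<alpha> (q x)) =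
      (\<Sum>(a, b)\<in>(\<lambda>x. (p x, q x)) ` (A - {l}). decay \<alpha> a * decay \<alpha> b)"
    by (subst sum.reindex) (auto intro: inj_on_subset[OF inj_pq])
  \<comment> \<open>Passing to the full rectangle of displacements adds only nonnegative terms and
    lets the double sum factor.\<close>
  also have "\<dots> \<le> (\<Sum>(a, b)\<in>p ` A \<times> q ` A. decay \<alpha> a * decay \<alpha> b)"
    using A(1) by (intro sum_mono2) (auto simp: decay_def)
  also have "\<dots> = (\<Sum>a\<in>p ` A. decay \<alpha> a) * (\<Sum>b\<in>q ` A. decay \<alpha> b)"
    by (simp add: sum_product sum.cartesian_product)
  also have "\<dots> \<le> (decay_total \<alpha>)\<^sup>2"
    unfolding power2_eq_square
  proof (rule mult_mono)
    show "decay_total \<alpha> \<ge> 0" using sum_decay_le[OF \<alpha>, of "{}"] by simp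
    show "(\<Sum>b\<in>q ` A. decay \<alpha> b) \<ge> 0" by (simp add: sum_nonneg decay_def)
  qed (use A(1) sum_decay_le[OF \<alpha>] in auto)
  finally have "(16 / K) powr \<alpha> * (\<Sum>x\<in>A - {l}. decay \<alpha> (p x) * decay \<alpha> (q x)) \<le>
      (16 / K) powr \<alpha> * (decay_total \<alpha>)\<^sup>2"
    by (rule mult_left_mono) simp
  moreover have "(\<Sum>x\<in>A - {l}. (4 * w / link_dist x l) powr \<alpha>) \<le>
      (16 / K) powr \<alpha> * (\<Sum>x\<in>A - {l}. decay \<alpha> (p x) * decay \<alpha> (q x))"
    unfolding sum_distrib_left by (intro sum_mono term_le)
  ultimately show "(\<Sum>x\<in>A - {l}. (4 * w / link_dist x l) powr \<alpha>) \<le> (16 / K) powr \<alpha> * (decay_total \<alpha>)\<^sup>2"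
    by (rule order_trans[rotated])
qed

text \<open>Moves the condition from extended nonnegative reals to reals. Positive distances keep
  all terms finite, and the multiplied-out inequality also covers a link without
  interferers.\<close>

lemma feasibleI:
  assumes "\<beta> \<ge> 0"
    and pos: "\<And>x. x \<in> A \<Longrightarrow> pw x > 0" "\<And>x. x \<in> A \<Longrightarrow> link_length x > 0"
      "\<And>l x. l \<in> A \<Longrightarrow> x \<in> A - {l} \<Longrightarrow> link_dist x l > 0"
    and interference: "\<And>l. l \<in> A \<Longrightarrow>
      \<beta> * (\<Sum>x\<in>A - {l}. pw x / link_dist x l powr \<alpha>) \<le> pw l / link_length l powr \<alpha>"
  shows "feasible \<alpha> \<beta> pw A"
  unfolding feasible_def
proof
  fix l assume l: "l \<in> A"
  let ?I = "\<Sum>x\<in>A - {l}. pw x / link_dist x l powr \<alpha>"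
  let ?s = "pw l / link_length l powr \<alpha>"
  have I: "?I \<ge> 0" using pos(1) by (intro sum_nonneg divide_nonneg_nonneg) (auto intro: less_imp_le)
  have s: "?s > 0" using pos(1,2)[OF l] by simp
  have "(\<Sum>x\<in>A - {l}. ennreal (pw x) / ennreal (link_dist x l powr \<alpha>)) =
      (\<Sum>x\<in>A - {l}. ennreal (pw x / link_dist x l powr \<alpha>))"
  proof (intro sum.cong refl)
    fix x assume x: "x \<in> A - {l}"
    then show "ennreal (pw x) / ennreal (link_dist x l powr \<alpha>) = ennreal (pw x / link_dist x l powr \<alpha>)"
      using pos(1)[of x] pos(3)[OF l x] by (intro divide_ennreal) auto
  qed
  also have "\<dots> = ennreal ?I"
    using pos(1) by (intro sum_ennreal divide_nonneg_nonneg) (auto intro: less_imp_le)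
  finally have sir: "sir \<alpha> pw A l = ennreal ?s / ennreal ?I"
    using pos(1,2)[OF l] by (simp add: sir_def divide_ennreal less_imp_le)
  show "ennreal \<beta> \<le> sir \<alpha> pw A l"
  proof (cases "?I = 0")
    case True
    then show ?thesis using pos(1,2)[OF l] by (simp add: sir ennreal_divide_zero top_unique)
  next
    case False
    with I have I: "?I > 0" by simp
    then have "\<beta> \<le> ?s / ?I" using interference[OF l] by (subst pos_le_divide_eq)
    then show ?thesis using s I by (simp add: sir divide_ennreal less_imp_le ennreal_leI)
  qed
qed

section \<open>Colouring the links\<close>

definition length_class :: "link \<Rightarrow> int" where
  "length_class l = \<lceil>log 2 (link_length l)\<rceil>"

text \<open>A quarter of the upper end of the length class, so that the lengths in the class range
  from 2 (exclusive) to 4 (inclusive) cell widths.\<close>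

definition cell_width :: "link \<Rightarrow> real" where
  "cell_width l = 2 powr (real_of_int (length_class l) - 2)"

definition cell_mod :: "nat \<Rightarrow> real \<Rightarrow> point \<Rightarrow> int \<times> int" where
  "cell_mod K w z = (fst (cell w z) mod int K, snd (cell w z) mod int K)"

definition colour :: "nat \<Rightarrow> link \<Rightarrow> int \<times> (int \<times> int) \<times> (int \<times> int)" where
  "colour K l = (length_class l, cell_mod K (cell_width l) (fst l), cell_mod K (cell_width l) (snd l))"

lemma cell_width_pos: "cell_width l > 0"
  by (simp add: cell_width_def)

lemma link_length_bounds:
  assumes "link_length l > 0"
  shows "2 * cell_width l < link_length l" "link_length l \<le> 4 * cell_width l"
proof -
  let ?m = "real_of_int (length_class l)"
  have "?m - 1 < log 2 (link_length l)" "log 2 (link_length l) \<le> ?m"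
    unfolding length_class_def by linarith+
  then have *: "2 powr (?m - 1) < link_length l" "link_length l \<le> 2 powr ?m"
    using assms by (simp_all add: less_log_iff log_le_iff)
  have "2 * cell_width l = 2 powr 1 * 2 powr (?m - 2)" by (simp add: cell_width_def)
  also have "\<dots> = 2 powr (?m - 1)" unfolding powr_add[symmetric] by simp
  finally show "2 * cell_width l < link_length l" using *(1) by simp
  have "4 * cell_width l = 2 powr 2 * 2 powr (?m - 2)" by (simp add: cell_width_def)
  also have "\<dots> = 2 powr ?m" unfolding powr_add[symmetric] by simp
  finally show "link_length l \<le> 4 * cell_width l" using *(2) by simp
qed

lemma int_eq_if_dvd_diff:
  fixes a b :: int
  assumes "int K dvd a - b" "\<bar>a - b\<bar> < int K"
  shows "a = b"
  using assms zdvd_not_zless[of "\<bar>a - b\<bar>" "int K"] by (cases "a = b") auto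

text \<open>A common sender cell keeps the receivers close, so equal residues force a common
  receiver cell; then the two long tree edges coincide.\<close>

lemma link_eq_if_same_colour:
  assumes P: "finite P" and L: "minimum_spanning_tree P L" and K: "(12::nat) \<le> K"
    and x: "{fst x, snd x} \<in> L" "link_length x > 0"
    and y: "{fst y, snd y} \<in> L" "link_length y > 0"
    and col: "colour K x = colour K y"
    and sender: "cell (cell_width x) (fst x) = cell (cell_width x) (fst y)"
  shows "x = y"
proof -
  let ?w = "cell_width x"
  have w: "cell_width y = ?w" using col by (simp add: colour_def cell_width_def)
  have long: "2 * ?w < dist (fst x) (snd x)" "2 * ?w < dist (fst y) (snd y)"
    and len: "dist (fst x) (snd x) \<le> 4 * ?w" "dist (fst y) (snd y) \<le> 4 * ?w"
    using link_length_bounds[OF x(2)] link_length_bounds[OF y(2)] w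
    by (simp_all add: link_length_def)
  have senders: "dist (fst x) (fst y) \<le> 2 * ?w"
    using dist_same_cell[OF cell_width_pos sender] .
  have "dist (snd x) (snd y) \<le> dist (fst x) (snd x) + dist (fst x) (fst y) + dist (fst y) (snd y)"
    by metric
  \<comment> \<open>Here 10 = 4 + 2 + 4: two link lengths and one cell diameter bound. Cell indices
    then differ by at most 11, whence \<open>K\<close> \<ge> 12.\<close>
  then have "dist (snd x) (snd y) \<le> real 10 * ?w"
    using len senders by simp
  note near = floor_diff_le_of_dist[OF cell_width_pos this]
  have "cell_mod K ?w (snd x) = cell_mod K ?w (snd y)"
    using col w by (simp add: colour_def)
  then have "int K dvd fst (cell ?w (snd x)) - fst (cell ?w (snd y))"
    "int K dvd snd (cell ?w (snd x)) - snd (cell ?w (snd y))"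
    by (simp_all add: cell_mod_def mod_eq_dvd_iff)
  then have "cell ?w (snd x) = cell ?w (snd y)"
    using near[of 1] near[of 2] K by (auto simp: cell_def intro!: int_eq_if_dvd_diff[of K])
  then have receivers: "dist (snd x) (snd y) \<le> 2 * ?w"
    by (rule dist_same_cell[OF cell_width_pos])
  have "{fst x, snd x} = {fst y, snd y}"
    using mst_long_edge_unique[OF P L x(1) y(1) long senders receivers] .
  \<comment> \<open>Opposite directions of one edge are excluded: their senders would be a full link
    length apart, more than two cell widths.\<close>
  then show "x = y"
    using senders long by (auto simp: doubleton_eq_iff prod_eq_iff dist_commute)
qed

section \<open>Feasible slots from colours, and the number of colours\<close>

lemma schedulable_by_colouring:
  fixes col :: "link \<Rightarrow> 'c"
  assumes "finite S" "\<And>c. feasible \<alpha> \<beta> pw {x\<in>S. col x = c}"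
  shows "\<exists>k. k \<le> card (col ` S) \<and> schedulable \<alpha> \<beta> pw S k"
proof -
  define Q where "Q = (\<lambda>c. {x\<in>S. col x = c}) ` col ` S"
  have "partition_on S Q"
    by (rule partition_onI) (auto simp: Q_def disjnt_def)
  moreover have "finite Q" "card Q \<le> card (col ` S)" "\<forall>A\<in>Q. feasible \<alpha> \<beta> pw A"
    using assms by (auto simp: Q_def card_image_le)
  ultimately show ?thesis unfolding schedulable_def by blast
qed

text \<open>\<open>pw_le\<close> is what both power schemes share: within a length class, every
  power is at most the signal received on \<open>l\<close> times (4 h)^\<alpha>, with h the cell
  width. The geometric bound then applies to either scheme.\<close>

lemma colour_class_feasible:
  assumes P: "finite P" and L: "minimum_spanning_tree P L"
    and \<alpha>: "\<alpha> > 2" and \<beta>: "\<beta> \<ge> 0"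
    and K: "(12::nat) \<le> K" "\<beta> * ((16 / K) powr \<alpha> * (decay_total \<alpha>)\<^sup>2) \<le> 1"
    and S: "finite S" "\<And>x. x \<in> S \<Longrightarrow> {fst x, snd x} \<in> L" "\<And>x. x \<in> S \<Longrightarrow> link_length x > 0"
    and pw_pos: "\<And>x. x \<in> S \<Longrightarrow> pw x > 0"
    and pw_le: "\<And>x l. x \<in> S \<Longrightarrow> l \<in> S \<Longrightarrow> length_class x = length_class l \<Longrightarrow>
      pw x * link_length l powr \<alpha> \<le> pw l * (4 * cell_width l) powr \<alpha>"
  shows "feasible \<alpha> \<beta> pw {x\<in>S. colour K x = c}"
proof (rule feasibleI[OF \<beta>])
  let ?A = "{x\<in>S. colour K x = c}"
  fix l assume l: "l \<in> ?A"
  let ?w = "cell_width l"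
  have w: "cell_width x = ?w" "length_class x = length_class l" if "x \<in> ?A" for x
    using l that by (auto simp: colour_def cell_width_def)
  have inj: "inj_on (\<lambda>x. cell ?w (fst x)) ?A"
  proof (rule inj_onI)
    fix x y assume xy: "x \<in> ?A" "y \<in> ?A" "cell ?w (fst x) = cell ?w (fst y)"
    then show "x = y"
      using w[of x] S by (intro link_eq_if_same_colour[OF P L K(1)]) auto
  qed
  have "cell_mod K ?w (fst x) = cell_mod K ?w (fst l)" if "x \<in> ?A" for x
    using l that w[OF that] by (auto simp: colour_def)
  then have cong: "int K dvd fst (cell ?w (fst x)) - fst (cell ?w (fst l))"
      "int K dvd snd (cell ?w (fst x)) - snd (cell ?w (fst l))" if "x \<in> ?A" for x
    using that by (simp_all add: cell_mod_def mod_eq_dvd_iff)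
  have len: "link_length l > 0" "link_length l \<le> 4 * ?w"
    using l S(3) link_length_bounds(2) by auto
  have K10: "K \<ge> 10" and A: "finite ?A" using K(1) S(1) by auto
  note grid = grid_interference[OF \<alpha> cell_width_pos K10 A l len(2) inj]
  let ?s = "pw l / link_length l powr \<alpha>"
  have s: "?s > 0" using pw_pos l len by simp
  show pos: "link_dist x l > 0" if "x \<in> ?A - {l}" for x
    using grid(1)[OF cong that] .
  have "(\<Sum>x\<in>?A - {l}. pw x / link_dist x l powr \<alpha>) \<le>
      (\<Sum>x\<in>?A - {l}. ?s * (4 * ?w / link_dist x l) powr \<alpha>)"
  proof (rule sum_mono)
    fix x assume x: "x \<in> ?A - {l}"
    have "pw x \<le> ?s * (4 * ?w) powr \<alpha>"
      using pw_le[of x l] x l w[of x] len(1) by (simp add: field_simps)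
    then have "pw x / link_dist x l powr \<alpha> \<le> ?s * (4 * ?w) powr \<alpha> / link_dist x l powr \<alpha>"
      by (intro divide_right_mono) auto
    also have "\<dots> = ?s * (4 * ?w / link_dist x l) powr \<alpha>"
      using pos[OF x] cell_width_pos[of l] by (simp add: powr_divide)
    finally show "pw x / link_dist x l powr \<alpha> \<le> ?s * (4 * ?w / link_dist x l) powr \<alpha>" .
  qed
  also have "\<dots> \<le> ?s * ((16 / K) powr \<alpha> * (decay_total \<alpha>)\<^sup>2)"
    unfolding sum_distrib_left[symmetric] using s grid(2)[OF cong] by (intro mult_left_mono) auto
  finally have "\<beta> * (\<Sum>x\<in>?A - {l}. pw x / link_dist x l powr \<alpha>) \<le>
      \<beta> * (?s * ((16 / K) powr \<alpha> * (decay_total \<alpha>)\<^sup>2))"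
    using \<beta> by (rule mult_left_mono)
  also have "\<dots> = ?s * (\<beta> * ((16 / K) powr \<alpha> * (decay_total \<alpha>)\<^sup>2))" by (simp only: mult_ac)
  also have "\<dots> \<le> ?s * 1" using s K(2) by (intro mult_left_mono) auto
  finally show "\<beta> * (\<Sum>x\<in>?A - {l}. pw x / link_dist x l powr \<alpha>) \<le> ?s" by simp
qed (use S pw_pos in auto)

lemma grid_period_exists:
  assumes "\<alpha> > 2" "\<beta> \<ge> 0"
  shows "\<exists>K. (12::nat) \<le> K \<and> \<beta> * ((16 / K) powr \<alpha> * (decay_total \<alpha>)\<^sup>2) \<le> 1"
proof -
  \<comment> \<open>The maximum with 1 makes the base 1/\<open>x\<close> at most 1, so the exponent
    \<alpha> can be lowered to 1; it also gives \<open>K\<close> \<ge> 16.\<close>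
  define x where "x = max 1 (\<beta> * (decay_total \<alpha>)\<^sup>2)"
  have x: "x \<ge> 1" "\<beta> * (decay_total \<alpha>)\<^sup>2 \<le> x" by (simp_all add: x_def)
  obtain K :: nat where K: "16 * x \<le> K" using real_arch_simple by blast
  have "(16 / K) powr \<alpha> \<le> (1 / x) powr \<alpha>"
    using K x(1) assms(1) by (intro powr_mono2) (auto simp: field_simps)
  also have "\<dots> \<le> (1 / x) powr 1"
    using x(1) assms(1) by (intro powr_mono') auto
  finally have "(16 / K) powr \<alpha> \<le> 1 / x" using x(1) by simp
  then have "(16 / K) powr \<alpha> * (\<beta> * (decay_total \<alpha>)\<^sup>2) \<le> (1 / x) * x"
    using x assms(2) by (intro mult_mono) auto
  then have "\<beta> * ((16 / K) powr \<alpha> * (decay_total \<alpha>)\<^sup>2) \<le> 1"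
    using x(1) by (simp add: mult_ac)
  moreover have "(12::nat) \<le> K" using K x(1) by linarith
  ultimately show ?thesis by blast
qed

text \<open>The fourth power counts residues for two coordinates of the sender and two of the
  receiver.\<close>

lemma card_colours_le:
  assumes "finite L" "K > 0" "\<And>x. x \<in> S \<Longrightarrow> {fst x, snd x} \<in> L"
  shows "card (colour K ` S) \<le> K ^ 4 * length_diversity L"
proof -
  let ?D = "{m. \<exists>e\<in>L. \<lceil>log 2 (edge_length e)\<rceil> = m}"
  let ?R = "{0..<int K}"
  have "?D = (\<lambda>e. \<lceil>log 2 (edge_length e)\<rceil>) ` L" by auto
  then have fin: "finite ?D" using assms(1) by simp
  have "length_class x \<in> ?D" if "x \<in> S" for x
    using assms(3)[OF that] by (auto simp: length_class_def link_length_def edge_length_pair[symmetric])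
  then have "colour K ` S \<subseteq> ?D \<times> (?R \<times> ?R) \<times> (?R \<times> ?R)"
    using assms(2) by (auto simp: colour_def cell_mod_def)
  then have "card (colour K ` S) \<le> card (?D \<times> (?R \<times> ?R) \<times> (?R \<times> ?R))"
    using fin by (intro card_mono) auto
  also have "\<dots> = K ^ 4 * length_diversity L"
    by (simp add: card_cartesian_product length_diversity_def power4_eq_xxxx mult_ac)
  finally show ?thesis .
qed

theorem theorem7:
  fixes \<alpha> \<beta> :: real
  assumes "\<alpha> > 2" and "\<beta> \<ge> 1"
  shows "\<exists>C::real. \<forall>(P :: point set) (L :: point set set).
           finite P \<longrightarrow> minimum_spanning_tree P L \<longrightarrow> (\<forall>e\<in>L. edge_length e \<ge> 1) \<longrightarrow>
             (\<exists>S k. orientation_of L S \<and> strongly_connects S P \<and>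
                real k \<le> C * real (length_diversity L) \<and>
                (\<exists>p>0. schedulable \<alpha> \<beta> (uniform_power p) S k)) \<and>
             (\<exists>S k. orientation_of L S \<and> strongly_connects S P \<and>
                real k \<le> C * real (length_diversity L) \<and>
                schedulable \<alpha> \<beta> (linear_power \<alpha>) S k)"
proof -
  \<comment> \<open>\<open>K\<close> is fixed before \<open>P\<close> and \<open>L\<close>, so the
    constant depends on \<alpha> and \<beta> only.\<close>
  obtain K :: nat where K: "(12::nat) \<le> K" "\<beta> * ((16 / K) powr \<alpha> * (decay_total \<alpha>)\<^sup>2) \<le> 1"
    using grid_period_exists[of \<alpha> \<beta>] assms by auto
  show ?thesis
  proof (rule exI[of _ "real (K ^ 4)"], intro allI impI)
    fix P :: "point set" and L :: "point set set"
    assume P: "finite P" and L: "minimum_spanning_tree P L" and "\<forall>e\<in>L. edge_length e \<ge> 1"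
    define S :: "link set" where "S = adj L"
    have sub: "L \<subseteq> edges_on P" and con: "connects L P"
      using L by (auto simp: minimum_spanning_tree_def spanning_tree_iff)
    have in_P: "a \<in> P" "b \<in> P" "a \<noteq> b" if "{a, b} \<in> L" for a b
      using subsetD[OF sub that] by (auto simp: edges_on_def doubleton_eq_iff)
    have finL: "finite L" using sub finite_edges_on[OF P] by (rule finite_subset)
    have S_PP: "S \<subseteq> P \<times> P" using in_P by (auto simp: S_def adj_def)
    then have finS: "finite S" using P by (meson finite_SigmaI finite_subset)
    have edge: "{fst x, snd x} \<in> L" if "x \<in> S" for x
      using that by (auto simp: S_def adj_def)
    have len: "link_length x > 0" if "x \<in> S" for x
      using in_P(3)[OF edge[OF that]] by (simp add: link_length_def)
    have "orientation_of L S"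
      unfolding orientation_of_def
    proof
      show "L \<subseteq> (\<lambda>(s, r). {s, r}) ` S"
      proof
        fix e assume e: "e \<in> L"
        then obtain u v where "e = {u, v}" using sub by (auto simp: edges_on_def)
        with e show "e \<in> (\<lambda>(s, r). {s, r}) ` S"
          by (intro image_eqI[of _ _ "(u, v)"]) (auto simp: S_def adj_def)
      qed
    qed (auto simp: S_def adj_def)
    moreover have "strongly_connects S P"
      using S_PP con in_P by (auto simp: strongly_connects_def connects_def S_def adj_def)
    moreover have slots: "\<exists>k. real k \<le> real (K ^ 4) * real (length_diversity L) \<and> schedulable \<alpha> \<beta> pw S k"
      if pw_pos: "\<And>x. x \<in> S \<Longrightarrow> pw x > 0"
        and pw_le: "\<And>x l. x \<in> S \<Longrightarrow> l \<in> S \<Longrightarrow> length_class x = length_class l \<Longrightarrow>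
          pw x * link_length l powr \<alpha> \<le> pw l * (4 * cell_width l) powr \<alpha>" for pw
    proof -
      have "feasible \<alpha> \<beta> pw {x\<in>S. colour K x = c}" for c
        using assms by (intro colour_class_feasible[OF P L _ _ K finS edge len pw_pos pw_le]) auto
      from schedulable_by_colouring[OF finS this]
      obtain k where k: "k \<le> card (colour K ` S)" "schedulable \<alpha> \<beta> pw S k" by blast
      have "card (colour K ` S) \<le> K ^ 4 * length_diversity L"
        using K(1) by (intro card_colours_le[OF finL _ edge]) auto
      with k have "real k \<le> real (K ^ 4 * length_diversity L)" by (intro of_nat_mono) auto
      with k show ?thesis by auto
    qed
    \<comment> \<open>Uniform power uses this with \<open>x\<close> equal to \<open>l\<close>; for
      linear power both sides are multiplied by the factor
      \<open>link_length l powr \<alpha>\<close>.\<close>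
    have len_le: "link_length x powr \<alpha> \<le> (4 * cell_width l) powr \<alpha>"
      if "x \<in> S" "length_class x = length_class l" for x l
      using link_length_bounds(2)[OF len[OF that(1)]] len[OF that(1)] that(2) assms(1)
      by (intro powr_mono2) (auto simp: cell_width_def)
    have "\<exists>k. real k \<le> real (K ^ 4) * real (length_diversity L) \<and>
        schedulable \<alpha> \<beta> (uniform_power 1) S k"
      by (rule slots) (auto simp: uniform_power_def intro: len_le)
    moreover have "\<exists>k. real k \<le> real (K ^ 4) * real (length_diversity L) \<and>
        schedulable \<alpha> \<beta> (linear_power \<alpha>) S k"
    proof (rule slots)
      fix x assume "x \<in> S"
      then show "linear_power \<alpha> x > 0" using len by (fastforce simp: linear_power_def)
    next
      fix x l assume "x \<in> S" "l \<in> S" "length_class x = length_class l"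
      then show "linear_power \<alpha> x * link_length l powr \<alpha> \<le> linear_power \<alpha> l * (4 * cell_width l) powr \<alpha>"
        using len_le[of x l] by (simp add: linear_power_def mult.commute mult_left_mono)
    qed
    ultimately show "(\<exists>S k. orientation_of L S \<and> strongly_connects S P \<and>
          real k \<le> real (K ^ 4) * real (length_diversity L) \<and>
          (\<exists>p>0. schedulable \<alpha> \<beta> (uniform_power p) S k)) \<and>
        (\<exists>S k. orientation_of L S \<and> strongly_connects S P \<and>
          real k \<le> real (K ^ 4) * real (length_diversity L) \<and>
          schedulable \<alpha> \<beta> (linear_power \<alpha>) S k)"
      using zero_less_one by blast
  qed
qed

end
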